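(* Let $b>0$ be a public budget and let $\hat V$ be a weakly correlated distribution, i.e. $\hat V=V_{|(\|v\|_1\le c)}$ for some $m$-dimensional independent distribution $V$ and some threshold $c>0$. For an additive buyer with public budget $b$ and valuations drawn from $\hat V$, $$\mathrm{Rev}^b(\hat V)\le 5\,\mathrm{SRev}^b(\hat V)+6\,\mathrm{BRev}^b(\hat V);$$ thus the better of selling separately and selling the grand bundle extracts a constant fraction of the optimal revenue.
   Context: A seller sells $m$ heterogeneous indivisible items (one copy each) to one additive buyer. The buyer's type is a vector of item values in $\mathbb{R}_{\ge0}^m$; his value for a set $S$ is $\sum_{j\in S}v_j$. Distributions are discrete (finitely supported). A distribution $V$ is independent if it is a product $\times_j V_j$. Write $\|v\|_1=\sum_j|v_j|$. For independent $V$ and $c>0$ with $\Pr_{v\sim V}[\|v\|_1\le c]>0$, $V_{|(\|v\|_1\le c)}$ denotes the law of $v\sim V$ conditioned on $\|v\|_1\le c$. For a distribution $D$ with support $T$ and probability mass function $f$: a mechanism is a pair $\pi:T\to[0,1]^m$, $p:T\to\mathbb{R}$, extended by $\pi(\varnothing)=0$, $p(\varnothing)=0$; it is truthful if $\pi(t)^\top t-p(t)\ge \pi(t')^\top t-p(t')$ for all $t\in T$, $t'\in T\cup\{\varnothing\}$. $\mathrm{Rev}^b(D)$ is the maximum of $\sum_{t\in T}f(t)p(t)$ over truthful mechanisms with $p(t)\le b$ for all $t\in T$. $\mathrm{SRev}^b(D)$ is the maximum expected revenue obtainable by posting item prices $p_1,\dots,p_m\ge0$, where a buyer of type $v$ buys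 a set $S$ maximizing $\sum_{j\in S}(v_j-p_j)$ subject to $\sum_{j\in S}p_j\le b$ (ties broken in favor of the seller). $\mathrm{BRev}^b(D)=\max_{0\le p\le b}\,p\cdot\Pr_{v\sim D}[\|v\|_1\ge p]$. *)

theory Defs
  imports "HOL-Probability.Product_PMF"
begin

text \<open>
  The items are the elements of a finite type \<open>'i\<close>, so that \<open>m = CARD('i)\<close> and a vector of item
  values is a function \<open>'i \<Rightarrow> real\<close>.
\<close>

type_synonym 'i valuation = "'i \<Rightarrow> real"

definition l1_norm :: "('i::finite) valuation \<Rightarrow> real" where
  "l1_norm v = (\<Sum>j\<in>UNIV. \<bar>v j\<bar>)"

definition value_distribution :: "('i::finite) valuation pmf \<Rightarrow> bool" where
  "value_distribution D \<longleftrightarrow> finite (set_pmf D) \<and> (\<forall>v\<in>set_pmf D. \<forall>j. 0 \<le> v j)"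

text \<open>The default value \<open>0\<close> is irrelevant, since the product is over all of \<open>UNIV\<close>.\<close>

definition independent_distribution :: "('i::finite) valuation pmf \<Rightarrow> bool" where
  "independent_distribution V \<longleftrightarrow>
     value_distribution V \<and> (\<exists>M :: 'i \<Rightarrow> real pmf. V = Pi_pmf UNIV 0 M)"

definition weakly_correlated :: "('i::finite) valuation pmf \<Rightarrow> bool" where
  "weakly_correlated D \<longleftrightarrow>
     (\<exists>V c. independent_distribution V \<and> c > 0 \<and>
        measure_pmf.prob V {v. l1_norm v \<le> c} > 0 \<and>
        D = cond_pmf V {v. l1_norm v \<le> c})"


subsection \<open>Optimal revenue\<close>

definition expected_payment :: "('i::finite) valuation pmf \<Rightarrow> ('i valuation \<Rightarrow> real) \<Rightarrow> real" where
  "expected_payment D p = (\<Sum>t\<in>set_pmf D. pmf D t * p t)"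

definition utility :: "('i::finite \<Rightarrow> real) \<Rightarrow> real \<Rightarrow> 'i valuation \<Rightarrow> real" where
  "utility x q t = (\<Sum>j\<in>UNIV. x j * t j) - q"

text \<open>
  The outside option \<open>\<emptyset>\<close>, with zero allocation and zero payment, is the report \<open>None\<close>.
  Only the values of \<open>x\<close> and \<open>p\<close> on the support of \<open>D\<close> matter.
\<close>

definition truthful_mechanism ::
  "('i::finite) valuation pmf \<Rightarrow> ('i valuation \<Rightarrow> 'i \<Rightarrow> real) \<Rightarrow> ('i valuation \<Rightarrow> real) \<Rightarrow> bool" where
  "truthful_mechanism D x p \<longleftrightarrow>
     (\<forall>t\<in>set_pmf D. \<forall>j. 0 \<le> x t j \<and> x t j \<le> 1) \<and>
     (\<forall>t\<in>set_pmf D. \<forall>r\<in>insert None (Some ` set_pmf D).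
        utility (x t) (p t) t \<ge>
        utility (case r of None \<Rightarrow> (\<lambda>j. 0) | Some t' \<Rightarrow> x t') (case r of None \<Rightarrow> 0 | Some t' \<Rightarrow> p t') t)"

definition mechanism_revenues :: "real \<Rightarrow> ('i::finite) valuation pmf \<Rightarrow> real set" where
  "mechanism_revenues b D =
     {expected_payment D p | x p. truthful_mechanism D x p \<and> (\<forall>t\<in>set_pmf D. p t \<le> b)}"

definition Rev :: "real \<Rightarrow> ('i::finite) valuation pmf \<Rightarrow> real" where
  "Rev b D = Sup (mechanism_revenues b D)"


subsection \<open>Selling separately\<close>

definition affordable :: "real \<Rightarrow> ('i::finite \<Rightarrow> real) \<Rightarrow> 'i set set" where
  "affordable b q = {S. (\<Sum>j\<in>S. q j) \<le> b}"

definition demand :: "real \<Rightarrow> ('i::finite \<Rightarrow> real) \<Rightarrow> 'i valuation \<Rightarrow> 'i set set" where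
  "demand b q v =
     {S \<in> affordable b q. \<forall>S'\<in>affordable b q. (\<Sum>j\<in>S'. v j - q j) \<le> (\<Sum>j\<in>S. v j - q j)}"

text \<open>Taking the maximal payment over the demanded bundles breaks ties in favor of the seller.\<close>

definition separate_payment :: "real \<Rightarrow> ('i::finite \<Rightarrow> real) \<Rightarrow> 'i valuation \<Rightarrow> real" where
  "separate_payment b q v = Max ((\<lambda>S. \<Sum>j\<in>S. q j) ` demand b q v)"

definition separate_revenues :: "real \<Rightarrow> ('i::finite) valuation pmf \<Rightarrow> real set" where
  "separate_revenues b D = {expected_payment D (separate_payment b q) | q. \<forall>j. 0 \<le> q j}"

definition SRev :: "real \<Rightarrow> ('i::finite) valuation pmf \<Rightarrow> real" where
  "SRev b D = Sup (separate_revenues b D)"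


subsection \<open>Selling the grand bundle\<close>

definition bundle_revenues :: "real \<Rightarrow> ('i::finite) valuation pmf \<Rightarrow> real set" where
  "bundle_revenues b D = {q * measure_pmf.prob D {v. l1_norm v \<ge> q} | q. 0 \<le> q \<and> q \<le> b}"

definition BRev :: "real \<Rightarrow> ('i::finite) valuation pmf \<Rightarrow> real" where
  "BRev b D = Sup (bundle_revenues b D)"


subsection \<open>The suprema are over nonempty sets that are bounded above\<close>

lemma expected_payment_le:
  assumes "finite (set_pmf D)" "\<And>t. t \<in> set_pmf D \<Longrightarrow> p t \<le> b"
  shows "expected_payment D p \<le> b"
proof -
  have "expected_payment D p \<le> (\<Sum>t\<in>set_pmf D. pmf D t * b)"
    unfolding expected_payment_def using assms by (intro sum_mono mult_left_mono) auto
  also have "\<dots> = b"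
    using assms(1) by (simp add: sum_distrib_right[symmetric] sum_pmf_eq_1)
  finally show ?thesis .
qed

lemma mechanism_revenues_nonempty:
  assumes "0 \<le> b"
  shows "mechanism_revenues b D \<noteq> {}"
proof -
  have "truthful_mechanism D (\<lambda>t j. 0) (\<lambda>t. 0)"
    by (auto simp: truthful_mechanism_def utility_def)
  thus ?thesis
    using assms unfolding mechanism_revenues_def by blast
qed

lemma mechanism_revenues_bdd_above:
  assumes "finite (set_pmf D)"
  shows "bdd_above (mechanism_revenues b D)"
  using expected_payment_le[OF assms] by (force simp: bdd_above_def mechanism_revenues_def)

lemma demand_nonempty:
  assumes "0 \<le> b"
  shows "demand b q v \<noteq> {}"
proof -
  let ?u = "\<lambda>S. \<Sum>j\<in>S. v j - q j"
  have "{} \<in> affordable b q"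
    using assms by (simp add: affordable_def)
  hence ne: "?u ` affordable b q \<noteq> {}" by blast
  have fin: "finite (?u ` affordable b q)" by simp
  obtain S where "S \<in> affordable b q" "?u S = Max (?u ` affordable b q)"
    using Max_in[OF fin ne] by auto
  hence "S \<in> demand b q v"
    by (auto simp: demand_def)
  thus ?thesis by blast
qed

lemma separate_payment_le:
  assumes "0 \<le> b"
  shows "separate_payment b q v \<le> b"
proof -
  have "finite (demand b q v)" by simp
  thus ?thesis
    using demand_nonempty[OF assms, of q v]
    by (auto simp: separate_payment_def demand_def affordable_def)
qed

lemma separate_revenues_nonempty: "separate_revenues b D \<noteq> {}"
proof -
  have "\<exists>q :: 'a \<Rightarrow> real. \<forall>j. 0 \<le> q j" by (intro exI[of _ "\<lambda>_. 0"]) simp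
  thus ?thesis unfolding separate_revenues_def by blast
qed

lemma separate_revenues_bdd_above:
  assumes "0 \<le> b" "finite (set_pmf D)"
  shows "bdd_above (separate_revenues b D)"
proof (rule bdd_aboveI)
  fix r assume "r \<in> separate_revenues b D"
  thus "r \<le> b"
    using expected_payment_le[OF assms(2)] separate_payment_le[OF assms(1)]
    by (auto simp: separate_revenues_def)
qed

lemma bundle_revenues_nonempty:
  assumes "0 \<le> b"
  shows "bundle_revenues b D \<noteq> {}"
  using assms unfolding bundle_revenues_def by blast

lemma bundle_revenues_bdd_above: "bdd_above (bundle_revenues b D)"
proof (rule bdd_aboveI)
  fix r assume "r \<in> bundle_revenues b D"
  then obtain q where q: "0 \<le> q" "q \<le> b" "r = q * measure_pmf.prob D {v. l1_norm v \<ge> q}"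
    by (auto simp: bundle_revenues_def)
  have "r \<le> q * 1"
    unfolding q(3) using q(1) by (intro mult_left_mono) auto
  thus "r \<le> b" using q(2) by simp
qed

end

theory Submission
  imports Defs
begin

text \<open>
  Let \<open>C = min b c\<close>, \<open>t = SRev\<close> and \<open>B = BRev\<close>. No payment exceeds \<open>C\<close>, so we may assume
  \<open>6 * B < C\<close>. Types of value above \<open>C / 2\<close> pay at most \<open>2 * B\<close> in expectation, and the other
  types form an event \<open>A\<close> of probability at least \<open>2 / 3\<close>. On \<open>A\<close>, the payment is at most the
  payment of a single-item mechanism for the favourite item plus the total value of the other
  items, which splits into values above \<open>t\<close> (tail) and values up to \<open>t\<close> (core).

  The correlation is dealt with by drawing two independent samples \<open>v\<close>, \<open>v'\<close>: a coordinate may be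
  exchanged between them as long as \<open>l1_norm v + l1_norm v' \<le> C\<close>, which includes \<open>A \<times> A\<close>. One
  exchange decouples the favourite item, and likewise each tail item, from the rest of the vector,
  so both contributions times \<open>P(A)\<close> are at most \<open>t\<close>. The exchanges also make the differences of
  distinct core coordinates uncorrelated, so the core values of the two samples differ by \<open>O(t)\<close>
  in mean square. Since the total value is at most \<open>2 * B\<close> with probability at least \<open>1 / 2\<close>, the
  core is at most \<open>2 * B + 2 * t\<close>.
\<close>

section \<open>Single-item mechanisms\<close>

text \<open>A finite form of Myerson's theorem: \<open>x z * z - u z\<close> is the payment of type
  \<open>z\<close> with utility \<open>u z\<close>, and \<open>R\<close> bounds every posted-price
  revenue. Removing the top type lets the bound telescope in the allocation, which is why it reads
  \<open>R * x (Max Z)\<close>.\<close>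

lemma single_item_revenue_le_Max:
  fixes Z :: "real set" and x u w :: "real \<Rightarrow> real"
  assumes "finite Z" "Z \<noteq> {}"
    and "\<And>z. z \<in> Z \<Longrightarrow> 0 \<le> w z"
    and "\<And>z. z \<in> Z \<Longrightarrow> 0 \<le> x z"
    and "\<And>z. z \<in> Z \<Longrightarrow> 0 \<le> u z"
    and "\<And>z z'. z \<in> Z \<Longrightarrow> z' \<in> Z \<Longrightarrow> u z' + x z' * (z - z') \<le> u z"
    and "\<And>q. q \<in> Z \<Longrightarrow> q * sum w {z \<in> Z. q \<le> z} \<le> R"
  shows "(\<Sum>z\<in>Z. w z * (x z * z - u z)) \<le> R * x (Max Z)"
  using assms
proof (induction Z arbitrary: w rule: finite_linorder_max_induct)
  case empty
  then show ?case by simp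
next
  case (insert a Z w)
  have aZ: "a \<notin> Z" using insert.hyps by auto
  have w_a: "0 \<le> w a" and x_a: "0 \<le> x a" and u_a: "0 \<le> u a"
    using insert.prems by auto
  have upper: "{z \<in> insert a Z. a \<le> z} = {a}" using insert.hyps by force
  have price_a: "a * w a \<le> R"
    using insert.prems(6)[of a] unfolding upper by simp
  show ?case
  proof (cases "Z = {}")
    case True
    have "w a * (x a * a - u a) \<le> w a * (x a * a)"
      using w_a u_a by (intro mult_left_mono) auto
    also have "\<dots> \<le> R * x a"
      using mult_right_mono[OF price_a x_a] by (simp add: algebra_simps)
    finally show ?thesis using True by simp
  next
    case False
    define d where "d = Max Z"
    have d: "d \<in> Z" "d < a" using False insert.hyps unfolding d_def by auto
    \<comment> \<open>The weight of the top type \<open>a\<close> moves to the next lower type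
      \<open>d\<close>, so posted prices in \<open>Z\<close> earn exactly what they earned
      before.\<close>
    define w' where "w' = w(d := w d + w a)"
    have sum_w': "(\<Sum>z\<in>Z. w' z * F z) = (\<Sum>z\<in>Z. w z * F z) + w a * F d" for F :: "real \<Rightarrow> real"
    proof -
      have "(\<Sum>z\<in>Z. w' z * F z) = (\<Sum>z\<in>Z. w z * F z + (if z = d then w a * F d else 0))"
        unfolding w'_def by (intro sum.cong) (auto simp: algebra_simps)
      then show ?thesis
        using insert.hyps d by (simp add: sum.distrib)
    qed
    have IH: "(\<Sum>z\<in>Z. w' z * (x z * z - u z)) \<le> R * x d"
      unfolding d_def
    proof (rule insert.IH)
      fix q assume q: "q \<in> Z"
      have "q \<le> d" using q insert.hyps unfolding d_def by simp
      then have mem: "d \<in> {z \<in> Z. q \<le> z}" using d by simp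
      have eq: "{z \<in> insert a Z. q \<le> z} = insert a {z \<in> Z. q \<le> z}"
        using insert.hyps q by force
      have "sum w' {z \<in> Z. q \<le> z} = (\<Sum>z | z \<in> Z \<and> q \<le> z. w z + (if z = d then w a else 0))"
        unfolding w'_def by (intro sum.cong) auto
      also have "\<dots> = sum w {z \<in> insert a Z. q \<le> z}"
        unfolding eq using mem aZ insert.hyps by (simp add: sum.distrib)
      finally show "q * sum w' {z \<in> Z. q \<le> z} \<le> R"
        using insert.prems(6)[of q] q by simp
    qed (use False insert.prems d in \<open>auto simp: w'_def\<close>)
    have ic: "u d + x d * (a - d) \<le> u a" "u a + x a * (d - a) \<le> u d"
      using insert.prems(5) d by auto
    have "(x d - x a) * (a - d) \<le> 0" using ic by (simp add: algebra_simps)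
    then have mono: "x d \<le> x a" using d by (simp add: mult_le_0_iff)
    \<comment> \<open>Since \<open>a\<close> does not prefer to report \<open>d\<close>, it pays at
      most \<open>a * (x a - x d)\<close> more than \<open>d\<close>; the price \<open>a\<close>
      earns \<open>a * w a\<close>.\<close>
    have "w a * ((x a * a - u a) - (x d * d - u d)) \<le> w a * (a * (x a - x d))"
      using w_a ic by (intro mult_left_mono) (auto simp: algebra_simps)
    also have "\<dots> \<le> R * (x a - x d)"
      using mult_right_mono[OF price_a, of "x a - x d"] mono by (simp add: algebra_simps)
    finally have step: "w a * ((x a * a - u a) - (x d * d - u d)) \<le> R * (x a - x d)" .
    have "Max (insert a Z) = a"
      using insert.hyps by (intro Max_eqI) force+
    then show ?thesis
      using IH step aZ insert.hyps sum_w'[of "\<lambda>z. x z * z - u z"]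
      by (simp add: algebra_simps)
  qed
qed

text \<open>Several indices may share a value, as happens when samples are projected to one
  coordinate. Their weights are pooled in \<open>\<omega>\<close> before the previous bound is
  applied.\<close>

lemma single_item_revenue_le:
  fixes z w :: "'a \<Rightarrow> real" and x u :: "real \<Rightarrow> real"
  assumes fin: "finite I" and R: "0 \<le> R"
    and w: "\<And>i. i \<in> I \<Longrightarrow> 0 \<le> w i"
    and x: "\<And>i. i \<in> I \<Longrightarrow> 0 \<le> x (z i) \<and> x (z i) \<le> 1"
    and u: "\<And>i. i \<in> I \<Longrightarrow> 0 \<le> u (z i)"
    and ic: "\<And>i k. i \<in> I \<Longrightarrow> k \<in> I \<Longrightarrow> u (z k) + x (z k) * (z i - z k) \<le> u (z i)"
    and price: "\<And>k. k \<in> I \<Longrightarrow> z k * sum w {i \<in> I. z k \<le> z i} \<le> R"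
  shows "(\<Sum>i\<in>I. w i * (x (z i) * z i - u (z i))) \<le> R"
proof (cases "I = {}")
  case True
  then show ?thesis using R by simp
next
  case False
  define \<omega> where "\<omega> = (\<lambda>s. sum w {i \<in> I. z i = s})"
  have "(\<Sum>i\<in>I. w i * (x (z i) * z i - u (z i)))
      = (\<Sum>s\<in>z ` I. \<Sum>i | i \<in> I \<and> z i = s. w i * (x (z i) * z i - u (z i)))"
    by (rule sum.image_gen[OF fin])
  also have "\<dots> = (\<Sum>s\<in>z ` I. \<omega> s * (x s * s - u s))"
    unfolding \<omega>_def sum_distrib_right by (intro sum.cong) auto
  also have "\<dots> \<le> R * x (Max (z ` I))"
  proof (rule single_item_revenue_le_Max)
    fix q assume "q \<in> z ` I"
    then obtain k where k: "k \<in> I" "q = z k" by auto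
    have "sum w {i \<in> I. q \<le> z i}
        = (\<Sum>s\<in>z ` {i \<in> I. q \<le> z i}. sum w {i \<in> {i \<in> I. q \<le> z i}. z i = s})"
      by (rule sum.image_gen) (use fin in simp)
    also have "\<dots> = sum \<omega> {s \<in> z ` I. q \<le> s}"
      unfolding \<omega>_def by (intro sum.cong) (auto intro!: arg_cong[where f = "sum w"])
    finally show "q * sum \<omega> {s \<in> z ` I. q \<le> s} \<le> R"
      using price[OF k(1)] k(2) by simp
  qed (use fin False w x u ic in \<open>auto simp: \<omega>_def intro!: sum_nonneg\<close>)
  also have "\<dots> \<le> R"
  proof -
    have "Max (z ` I) \<in> z ` I" using fin False by (intro Max_in) auto
    then obtain i where "i \<in> I" "Max (z ` I) = z i" by (metis imageE)
    then show ?thesis using x[of i] R by (simp add: mult_left_le)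
  qed
  finally show ?thesis .
qed

text \<open>This replaces integrating \<open>2 * s\<close> times the weight of values at least
  \<open>s\<close> over \<open>s\<close> from 0 to \<open>t\<close>, where the integrand is at most
  \<open>2 * R\<close>.\<close>

lemma sum_squares_le_of_price_bound:
  fixes z w :: "'a \<Rightarrow> real"
  assumes fin: "finite I" and t: "0 < t" and R: "0 \<le> R"
    and w: "\<And>i. i \<in> I \<Longrightarrow> 0 \<le> w i"
    and z: "\<And>i. i \<in> I \<Longrightarrow> 0 \<le> z i \<and> z i \<le> t"
    and price: "\<And>k. k \<in> I \<Longrightarrow> z k * sum w {i \<in> I. z k \<le> z i} \<le> R"
  shows "(\<Sum>i\<in>I. w i * (z i)\<^sup>2) \<le> 2 * t * R"
proof -
  \<comment> \<open>The mechanism with utility \<open>s\<^sup>2 / (2 * t)\<close> also collects \<open>s\<^sup>2 / (2 * t)\<close> from type \<open>s\<close>.\<close>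
  have "(\<Sum>i\<in>I. w i * (z i / t * z i - (z i)\<^sup>2 / (2 * t))) \<le> R"
  proof (rule single_item_revenue_le[where x = "\<lambda>s. s / t" and u = "\<lambda>s. s\<^sup>2 / (2 * t)"])
    fix i k assume "i \<in> I" "k \<in> I"
    have "0 \<le> (z i - z k)\<^sup>2 / (2 * t)" using t by simp
    also have "\<dots> = (z i)\<^sup>2 / (2 * t) - ((z k)\<^sup>2 / (2 * t) + z k / t * (z i - z k))"
      using t by (simp add: power2_eq_square field_simps)
    finally show "(z k)\<^sup>2 / (2 * t) + z k / t * (z i - z k) \<le> (z i)\<^sup>2 / (2 * t)" by simp
  qed (use assms in auto)
  also have "(\<Sum>i\<in>I. w i * (z i / t * z i - (z i)\<^sup>2 / (2 * t))) = (\<Sum>i\<in>I. w i * (z i)\<^sup>2) / (2 * t)"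
    unfolding sum_divide_distrib using t
    by (intro sum.cong) (auto simp: power2_eq_square field_simps)
  finally show ?thesis using t by (simp add: field_simps)
qed


section \<open>Posted prices\<close>

lemma l1_norm_nonneg: "0 \<le> l1_norm v"
  by (simp add: l1_norm_def sum_nonneg)

lemma l1_norm_eq_sum: "(\<And>j. 0 \<le> v j) \<Longrightarrow> l1_norm v = sum v UNIV"
  by (simp add: l1_norm_def)

lemma l1_norm_swap:
  "l1_norm (v(j := v' j)) + l1_norm (v'(j := v j)) = l1_norm v + l1_norm v'"
  unfolding l1_norm_def sum.distrib[symmetric] by (intro sum.cong) auto

lemma separate_payment_nonneg:
  assumes "0 \<le> b" "\<And>j. 0 \<le> q j"
  shows "0 \<le> separate_payment b q v"
proof -
  obtain S where "S \<in> demand b q v" using demand_nonempty[OF assms(1)] by blast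
  then have "sum q S \<le> separate_payment b q v"
    unfolding separate_payment_def by (intro Max_ge) auto
  moreover have "0 \<le> sum q S" by (intro sum_nonneg assms(2))
  ultimately show ?thesis by linarith
qed

text \<open>A buyer whose total value is within the budget can afford every item priced at most its
  value, and this set maximizes his surplus.\<close>

lemma separate_payment_ge:
  assumes v: "\<And>j. 0 \<le> v j" and le: "l1_norm v \<le> b"
  shows "(\<Sum>j | q j \<le> v j. q j) \<le> separate_payment b q v"
proof -
  let ?S = "{j. q j \<le> v j}"
  have "sum q ?S \<le> sum v ?S" by (intro sum_mono) simp
  also have "\<dots> \<le> sum v UNIV" using v by (intro sum_mono2) auto
  also have "\<dots> \<le> b" using le l1_norm_eq_sum[of v] v by simp
  finally have aff: "?S \<in> affordable b q" by (simp add: affordable_def)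
  have "(\<Sum>j\<in>S'. v j - q j) \<le> (\<Sum>j\<in>?S. v j - q j)" for S' :: "'a set"
  proof -
    have "(\<Sum>j\<in>S'. v j - q j) \<le> (\<Sum>j\<in>S'. if q j \<le> v j then v j - q j else 0)"
      by (intro sum_mono) auto
    also have "\<dots> \<le> (\<Sum>j\<in>UNIV. if q j \<le> v j then v j - q j else 0)"
      by (intro sum_mono2) auto
    also have "\<dots> = (\<Sum>j\<in>?S. v j - q j)"
      by (simp add: sum.If_cases)
    finally show ?thesis .
  qed
  with aff have "?S \<in> demand b q v" by (simp add: demand_def)
  then show ?thesis unfolding separate_payment_def by (intro Max_ge) auto
qed

lemma SRev_nonneg:
  assumes "0 \<le> b" "finite (set_pmf D)"
  shows "0 \<le> SRev b D"
proof -
  have "expected_payment D (separate_payment b (\<lambda>_. 0)) \<le> SRev b D"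
    unfolding SRev_def using separate_revenues_bdd_above[OF assms]
    by (intro cSup_upper) (auto simp: separate_revenues_def)
  moreover have "0 \<le> expected_payment D (separate_payment b (\<lambda>_. 0))"
    unfolding expected_payment_def using assms
    by (intro sum_nonneg mult_nonneg_nonneg separate_payment_nonneg) auto
  ultimately show ?thesis by linarith
qed

lemma BRev_upper:
  assumes "0 \<le> q" "q \<le> b"
  shows "q * measure_pmf.prob D {v. q \<le> l1_norm v} \<le> BRev b D"
  unfolding BRev_def using assms bundle_revenues_bdd_above[of b D]
  by (intro cSup_upper) (auto simp: bundle_revenues_def)


text \<open>With \<open>f\<close> a probability mass function, this introduces a second independent
  sample at the cost of the factor P(\<open>S\<close>).\<close>

lemma weighted_sum_product:
  fixes f g :: "'a \<Rightarrow> real"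
  shows "(\<Sum>v\<in>S. f v) * (\<Sum>v\<in>R. f v * g v) = (\<Sum>v\<in>R. \<Sum>v'\<in>S. f v * f v' * g v)"
  unfolding sum_product by (subst sum.swap) (simp add: algebra_simps)


section \<open>Exchanging coordinates of two independent samples\<close>

text \<open>The exchange identity is all that is kept of the product structure. An exchange
  preserves the sum of the two norms, so bounding that sum by at most the conditioning threshold
  keeps both new vectors inside the conditioning event.\<close>

locale exchangeable_values =
  fixes D :: "('i::finite) valuation pmf" and C :: real
  assumes value_distribution: "value_distribution D"
    and pmf_swap: "\<And>v v' j. l1_norm v + l1_norm v' \<le> C \<Longrightarrow>
      pmf D (v(j := v' j)) * pmf D (v'(j := v j)) = pmf D v * pmf D v'"
begin

text \<open>\<open>E2\<close> is an expectation restricted to \<open>low_pairs\<close>, without normalization.\<close>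

definition low :: "real \<Rightarrow> 'i valuation set" where
  "low r = {v \<in> set_pmf D. l1_norm v \<le> r}"

definition low_pairs :: "('i valuation \<times> 'i valuation) set" where
  "low_pairs = {(v, v'). v \<in> set_pmf D \<and> v' \<in> set_pmf D \<and> l1_norm v + l1_norm v' \<le> C}"

definition E2 :: "('i valuation \<Rightarrow> 'i valuation \<Rightarrow> real) \<Rightarrow> real" where
  "E2 h = (\<Sum>(v, v')\<in>low_pairs. pmf D v * pmf D v' * h v v')"

lemma finite_support: "finite (set_pmf D)"
  and value_nonneg: "v \<in> set_pmf D \<Longrightarrow> 0 \<le> v j"
  using value_distribution by (auto simp: value_distribution_def)

lemma finite_low [simp]: "finite (low r)"
  using finite_support by (simp add: low_def)

lemma lowD: "v \<in> low r \<Longrightarrow> v \<in> set_pmf D" "v \<in> low r \<Longrightarrow> l1_norm v \<le> r"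
  by (simp_all add: low_def)

lemma low_pairs_subset: "low_pairs \<subseteq> low C \<times> low C"
proof
  fix z assume z: "z \<in> low_pairs"
  obtain v v' where [simp]: "z = (v, v')" by force
  show "z \<in> low C \<times> low C"
    using z l1_norm_nonneg[of v] l1_norm_nonneg[of v'] by (auto simp: low_pairs_def low_def)
qed

lemma finite_low_pairs [simp]: "finite low_pairs"
  using finite_subset[OF low_pairs_subset] by simp

lemma low_times_low_subset: "r + s \<le> C \<Longrightarrow> low r \<times> low s \<subseteq> low_pairs"
  by (auto simp: low_def low_pairs_def)

text \<open>The exchange identity makes the product of the new probabilities nonzero, so both new
  vectors lie in the support.\<close>

lemma swap_in_low_pairs:
  assumes "(v, v') \<in> low_pairs"
  shows "(v(j := v' j), v'(j := v j)) \<in> low_pairs"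
proof -
  have *: "v \<in> set_pmf D" "v' \<in> set_pmf D" "l1_norm v + l1_norm v' \<le> C"
    using assms by (auto simp: low_pairs_def)
  have "pmf D (v(j := v' j)) * pmf D (v'(j := v j)) \<noteq> 0"
    using * by (simp add: pmf_swap set_pmf_iff)
  then show ?thesis
    using * by (auto simp: low_pairs_def l1_norm_swap set_pmf_iff)
qed

lemma E2_swap: "E2 h = E2 (\<lambda>v v'. h (v(j := v' j)) (v'(j := v j)))"
  unfolding E2_def
proof (rule sum.reindex_bij_witness[where
      i = "\<lambda>(v, v'). (v(j := v' j), v'(j := v j))" and j = "\<lambda>(v, v'). (v(j := v' j), v'(j := v j))"])
  fix z assume z: "z \<in> low_pairs"
  obtain v v' where [simp]: "z = (v, v')" by force
  have "l1_norm v + l1_norm v' \<le> C" using z by (auto simp: low_pairs_def)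
  then show "(case case z of (v, v') \<Rightarrow> (v(j := v' j), v'(j := v j)) of
      (v, v') \<Rightarrow> pmf D v * pmf D v' * h (v(j := v' j)) (v'(j := v j))) =
      (case z of (v, v') \<Rightarrow> pmf D v * pmf D v' * h v v')"
    by (simp add: pmf_swap)
qed (use swap_in_low_pairs in auto)

lemma E2_mono:
  assumes "\<And>v v'. (v, v') \<in> low_pairs \<Longrightarrow> h v v' \<le> k v v'"
  shows "E2 h \<le> E2 k"
  unfolding E2_def by (intro sum_mono) (auto intro!: mult_left_mono assms)

lemma E2_sum: "E2 (\<lambda>v v'. \<Sum>i\<in>I. h i v v') = (\<Sum>i\<in>I. E2 (h i))"
  unfolding E2_def by (subst sum.swap) (auto simp: sum_distrib_left intro!: sum.cong)

lemma E2_add: "E2 (\<lambda>v v'. h v v' + k v v') = E2 h + E2 k"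
  unfolding E2_def by (auto simp: sum.distrib[symmetric] algebra_simps intro!: sum.cong)

lemma E2_cmult: "E2 (\<lambda>v v'. a * h v v') = a * E2 h"
  unfolding E2_def by (auto simp: sum_distrib_left intro!: sum.cong)

text \<open>An exchange can leave \<open>low r \<times> low s\<close>, but not
  \<open>low_pairs\<close>; the product event therefore enters \<open>E2\<close> as an
  indicator.\<close>

lemma sum_low_times_low_eq_E2:
  assumes "r + s \<le> C"
  shows "(\<Sum>v\<in>low r. \<Sum>v'\<in>low s. pmf D v * pmf D v' * h v v')
    = E2 (\<lambda>v v'. of_bool (v \<in> low r \<and> v' \<in> low s) * h v v')"
  unfolding E2_def sum.cartesian_product
  using low_times_low_subset[OF assms] by (intro sum.mono_neutral_cong_left) auto

lemma E2_iterated: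
  "E2 h = (\<Sum>v\<in>low C. pmf D v * (\<Sum>v' | (v, v') \<in> low_pairs. pmf D v' * h v v'))"
proof -
  have fin: "finite {v'. (v, v') \<in> low_pairs}" for v
    using finite_support by (rule rev_finite_subset) (auto simp: low_pairs_def)
  have "low_pairs = Sigma (low C) (\<lambda>v. {v'. (v, v') \<in> low_pairs})"
    using low_pairs_subset by auto
  then have "E2 h = (\<Sum>(v, v')\<in>Sigma (low C) (\<lambda>v. {v'. (v, v') \<in> low_pairs}).
      pmf D v * pmf D v' * h v v')"
    unfolding E2_def by simp
  also have "\<dots> = (\<Sum>v\<in>low C. \<Sum>v' | (v, v') \<in> low_pairs. pmf D v * pmf D v' * h v v')"
    using fin by (intro sum.Sigma[symmetric]) auto
  finally show ?thesis by (simp add: sum_distrib_left mult.assoc)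
qed

lemma E2_le_sum_low_times_low:
  assumes "\<And>v v'. v \<in> low C \<Longrightarrow> v' \<in> low C \<Longrightarrow> 0 \<le> h v v'"
  shows "E2 h \<le> (\<Sum>v\<in>low C. \<Sum>v'\<in>low C. pmf D v * pmf D v' * h v v')"
  unfolding E2_def sum.cartesian_product
  using low_pairs_subset assms by (intro sum_mono2) auto

lemma sum_low_le_1: "(\<Sum>v\<in>low r. pmf D v) \<le> 1"
proof -
  have "(\<Sum>v\<in>low r. pmf D v) \<le> (\<Sum>v\<in>set_pmf D. pmf D v)"
    using finite_support by (intro sum_mono2) (auto simp: low_def)
  then show ?thesis using finite_support by (simp add: sum_pmf_eq_1)
qed

lemma sum_low_eq: "(\<Sum>v\<in>low r. pmf D v) = 1 - (\<Sum>v\<in>set_pmf D - low r. pmf D v)"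
proof -
  have "(\<Sum>v\<in>set_pmf D. pmf D v) = 1" using finite_support by (simp add: sum_pmf_eq_1)
  moreover have "(\<Sum>v\<in>set_pmf D. pmf D v)
      = (\<Sum>v\<in>set_pmf D - low r. pmf D v) + (\<Sum>v\<in>low r. pmf D v)"
    using finite_support by (intro sum.subset_diff) (auto simp: low_def)
  ultimately show ?thesis by linarith
qed

end

text \<open>Upper bounds \<open>t\<close> and \<open>B\<close> stand in for the two revenues because
  they must be positive to be divided by.\<close>

locale revenue_bounds = exchangeable_values D C
  for D :: "('i::finite) valuation pmf" and C :: real +
  fixes b t B :: real
  assumes C_pos: "0 < C" and C_le: "C \<le> b"
    and t_pos: "0 < t" and SRev_le: "SRev b D \<le> t"
    and B_pos: "0 < B" and BRev_le: "BRev b D \<le> B"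
    and B_less: "6 * B < C"
begin

section \<open>Probabilities and revenues controlled by posted prices\<close>

lemma b_pos: "0 < b"
  using C_pos C_le by linarith

lemma bundle_price: "0 \<le> q \<Longrightarrow> q \<le> b \<Longrightarrow> q * (\<Sum>v\<in>set_pmf D - low q. pmf D v) \<le> B"
proof -
  assume q: "0 \<le> q" "q \<le> b"
  have "(\<Sum>v\<in>set_pmf D - low q. pmf D v) = measure_pmf.prob D (set_pmf D - low q)"
    using finite_support by (simp add: measure_measure_pmf_finite)
  also have "\<dots> \<le> measure_pmf.prob D {v. q \<le> l1_norm v}"
    by (intro measure_pmf.finite_measure_mono) (auto simp: low_def)
  finally have "q * (\<Sum>v\<in>set_pmf D - low q. pmf D v) \<le> q * measure_pmf.prob D {v. q \<le> l1_norm v}"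
    using q by (intro mult_left_mono) auto
  also have "\<dots> \<le> B" using BRev_upper[OF q, of D] BRev_le by linarith
  finally show ?thesis .
qed

lemma prob_above_half: "C * (\<Sum>v\<in>set_pmf D - low (C / 2). pmf D v) \<le> 2 * B"
  using bundle_price[of "C / 2"] C_pos C_le by simp

text \<open>The level \<open>C / 2\<close> is the largest for which any two low samples have norms
  summing to at most \<open>C\<close>; \<open>6 * B < C\<close> makes the complement have
  probability at most 1/3.\<close>

lemma prob_low_half: "2 / 3 \<le> (\<Sum>v\<in>low (C / 2). pmf D v)"
proof -
  have "3 * (C * (\<Sum>v\<in>set_pmf D - low (C / 2). pmf D v)) \<le> C * 1"
    using prob_above_half B_less by linarith
  then have "C * (3 * (\<Sum>v\<in>set_pmf D - low (C / 2). pmf D v)) \<le> C * 1"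
    by (simp add: algebra_simps)
  then have "3 * (\<Sum>v\<in>set_pmf D - low (C / 2). pmf D v) \<le> 1"
    using C_pos mult_le_cancel_left_pos by blast
  then show ?thesis using sum_low_eq[of "C / 2"] by simp
qed

lemma prob_low_2B: "1 / 2 \<le> (\<Sum>v\<in>low (2 * B). pmf D v)"
proof -
  have "2 * B * (\<Sum>v\<in>set_pmf D - low (2 * B). pmf D v) \<le> B"
    using bundle_price[of "2 * B"] B_pos B_less C_le by simp
  then have "B * (2 * (\<Sum>v\<in>set_pmf D - low (2 * B). pmf D v)) \<le> B * 1" by simp
  then have "2 * (\<Sum>v\<in>set_pmf D - low (2 * B). pmf D v) \<le> 1"
    using B_pos mult_le_cancel_left_pos by blast
  then show ?thesis using sum_low_eq[of "2 * B"] by simp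
qed

text \<open>On \<open>low C\<close> the budget does not bind because \<open>C \<le> b\<close>, so
  items sell independently of each other; all remaining types pay a nonnegative amount.\<close>

lemma item_prices:
  assumes q: "\<And>j. 0 \<le> q j"
  shows "(\<Sum>j\<in>UNIV. q j * (\<Sum>v | v \<in> low C \<and> q j \<le> v j. pmf D v)) \<le> t"
proof -
  have "(\<Sum>j\<in>UNIV. q j * (\<Sum>v | v \<in> low C \<and> q j \<le> v j. pmf D v))
      = (\<Sum>j\<in>UNIV. \<Sum>v\<in>low C. if q j \<le> v j then pmf D v * q j else 0)"
    by (auto simp: sum_distrib_left sum.inter_filter intro!: sum.cong)
  also have "\<dots> = (\<Sum>v\<in>low C. \<Sum>j\<in>UNIV. if q j \<le> v j then pmf D v * q j else 0)"
    by (rule sum.swap)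
  also have "\<dots> = (\<Sum>v\<in>low C. pmf D v * (\<Sum>j | q j \<le> v j. q j))"
    by (intro sum.cong) (auto simp: sum_distrib_left sum.If_cases)
  also have "\<dots> \<le> (\<Sum>v\<in>low C. pmf D v * separate_payment b q v)"
    using C_le by (intro sum_mono mult_left_mono separate_payment_ge)
      (auto dest: lowD intro: value_nonneg)
  also have "\<dots> \<le> expected_payment D (separate_payment b q)"
    unfolding expected_payment_def using finite_support b_pos q
    by (intro sum_mono2 mult_nonneg_nonneg separate_payment_nonneg) (auto simp: low_def)
  also have "\<dots> \<le> SRev b D"
    unfolding SRev_def using q separate_revenues_bdd_above[OF _ finite_support, of b] b_pos
    by (intro cSup_upper) (auto simp: separate_revenues_def)
  finally show ?thesis using SRev_le by linarith
qed

lemma uniform_price: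
  assumes "0 \<le> q"
  shows "q * (\<Sum>v\<in>low C. \<Sum>j\<in>UNIV. pmf D v * of_bool (q \<le> v j)) \<le> t"
proof -
  have "q * (\<Sum>v\<in>low C. \<Sum>j\<in>UNIV. pmf D v * of_bool (q \<le> v j))
      = (\<Sum>j\<in>UNIV. q * (\<Sum>v | v \<in> low C \<and> q \<le> v j. pmf D v))"
    by (subst sum.swap) (auto simp: sum_distrib_left[symmetric] sum.inter_filter of_bool_def
        if_distrib[of "\<lambda>x. _ * x"] cong: if_cong)
  also have "\<dots> \<le> t" using item_prices[of "\<lambda>_. q"] assms by simp
  finally show ?thesis .
qed

text \<open>\<open>\<rho> j\<close> is the best posted-price revenue of item \<open>j\<close> alone.
  Posting all the best prices simultaneously bounds their sum.\<close>

lemma optimal_item_revenues: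
  obtains \<rho> where "\<And>j. 0 \<le> \<rho> j" "(\<Sum>j\<in>UNIV. \<rho> j) \<le> t"
    and "\<And>j v. v \<in> low C \<Longrightarrow> v j * (\<Sum>v' | v' \<in> low C \<and> v j \<le> v' j. pmf D v') \<le> \<rho> j"
proof -
  define rev where "rev = (\<lambda>j q. q * (\<Sum>v' | v' \<in> low C \<and> q \<le> v' j. pmf D v'))"
  \<comment> \<open>The extra price 0 guarantees a nonnegative maximum.\<close>
  define Y where "Y = (\<lambda>j. insert 0 ((\<lambda>v. v j) ` low C))"
  have "\<exists>q\<in>Y j. \<forall>q'\<in>Y j. rev j q' \<le> rev j q" for j
  proof -
    have fin: "finite (rev j ` Y j)" and ne: "rev j ` Y j \<noteq> {}" by (auto simp: Y_def)
    obtain q where q: "q \<in> Y j" "rev j q = Max (rev j ` Y j)"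
      using Max_in[OF fin ne] by force
    show ?thesis using q fin by (intro bexI[of _ q]) auto
  qed
  then obtain q where q: "\<And>j. q j \<in> Y j" "\<And>j q'. q' \<in> Y j \<Longrightarrow> rev j q' \<le> rev j (q j)"
    by metis
  show ?thesis
  proof (rule that[of "\<lambda>j. rev j (q j)"])
    show "0 \<le> rev j (q j)" for j
      using q(2)[of 0 j] by (simp add: Y_def rev_def)
    have "0 \<le> q j" for j
      using q(1)[of j] value_nonneg lowD(1) by (fastforce simp: Y_def)
    then show "(\<Sum>j\<in>UNIV. rev j (q j)) \<le> t"
      unfolding rev_def by (rule item_prices)
    show "v j * (\<Sum>v' | v' \<in> low C \<and> v j \<le> v' j. pmf D v') \<le> rev j (q j)" if "v \<in> low C" for j v
      using q(2)[of "v j" j] that by (simp add: Y_def rev_def)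
  qed
qed


end

section \<open>Bounding the revenue of a mechanism\<close>

lemma utility_upd: "utility y q (v(j := s)) = utility y q v + y j * (s - v j)"
proof -
  have "(\<Sum>k\<in>UNIV. y k * (v(j := s)) k) = (\<Sum>k\<in>UNIV. y k * v k + (if k = j then y j * (s - v j) else 0))"
    by (intro sum.cong) (auto simp: algebra_simps)
  then show ?thesis by (simp add: utility_def sum.distrib)
qed

text \<open>Choosing one maximizer makes the events \<open>favourite v = j\<close> a partition of
  the types.\<close>

definition favourite :: "('i::finite) valuation \<Rightarrow> 'i" where
  "favourite v = (SOME j. \<forall>k. v k \<le> v j)"

lemma le_favourite: "v k \<le> v (favourite v)"
proof -
  have "Max (range v) \<in> range v" by (intro Max_in) auto
  then obtain j where "Max (range v) = v j" by (metis imageE)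
  then have "\<forall>k. v k \<le> v j" by (metis Max_ge finite finite_imageI rangeI)
  then have "\<forall>k. v k \<le> v (favourite v)"
    unfolding favourite_def by (rule someI)
  then show ?thesis by blast
qed

lemma truthful_mechanismD:
  assumes "truthful_mechanism D x p" "v \<in> set_pmf D"
  shows "0 \<le> x v j" "x v j \<le> 1" "0 \<le> utility (x v) (p v) v"
    and "v' \<in> set_pmf D \<Longrightarrow> utility (x v') (p v') v \<le> utility (x v) (p v) v"
proof -
  have *: "utility (case r of None \<Rightarrow> (\<lambda>j. 0) | Some t' \<Rightarrow> x t') (case r of None \<Rightarrow> 0 | Some t' \<Rightarrow> p t') v
      \<le> utility (x v) (p v) v" if "r \<in> insert None (Some ` set_pmf D)" for r
    using assms that unfolding truthful_mechanism_def by blast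
  show "0 \<le> x v j" "x v j \<le> 1" using assms by (auto simp: truthful_mechanism_def)
  show "0 \<le> utility (x v) (p v) v" using *[of None] by (simp add: utility_def)
  show "utility (x v') (p v') v \<le> utility (x v) (p v) v" if "v' \<in> set_pmf D"
    using *[of "Some v'"] that by simp
qed

context revenue_bounds
begin

text \<open>
  Along a line in the direction of item \<open>j\<close>, a truthful mechanism is a single-item mechanism for
  item \<open>j\<close> with payments \<open>x v j * v j - utility\<close>.
\<close>

lemma favourite_revenue_le:
  assumes mech: "truthful_mechanism D x p"
  shows "(\<Sum>v\<in>low (C / 2). pmf D v *
    (x v (favourite v) * v (favourite v) - utility (x v) (p v) v)) \<le> 3 / 2 * t"
proof -
  define A where "A = low (C / 2)"
  define \<pi> where "\<pi> = (\<lambda>j v. x v j * v j - utility (x v) (p v) v)"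
  define h where "h = (\<lambda>j v v'. of_bool (v \<in> A \<and> favourite v = j \<and> v' \<in> A) * \<pi> j v)"
  obtain \<rho> where \<rho>: "\<And>j. 0 \<le> \<rho> j" "(\<Sum>j\<in>UNIV. \<rho> j) \<le> t"
    "\<And>j v. v \<in> low C \<Longrightarrow> v j * (\<Sum>v' | v' \<in> low C \<and> v j \<le> v' j. pmf D v') \<le> \<rho> j"
    using optimal_item_revenues by blast
  \<comment> \<open>After exchanging item \<open>j\<close>, the fixed \<open>v\<close> determines
    the line and only \<open>v' j\<close> varies along it. The set \<open>I\<close> keeps the points
    of the line that lie in the support, where truthfulness applies.\<close>
  have line: "(\<Sum>v' | (v, v') \<in> low_pairs. pmf D v' * h j (v(j := v' j)) (v'(j := v j))) \<le> \<rho> j" for j v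
  proof -
    define I where "I = {v'. (v, v') \<in> low_pairs \<and> v(j := v' j) \<in> A \<and>
      favourite (v(j := v' j)) = j \<and> v'(j := v j) \<in> A}"
    have I_low: "v' \<in> low C" if "v' \<in> I" for v'
      using that low_pairs_subset by (auto simp: I_def)
    have I_supp: "v(j := v' j) \<in> set_pmf D" if "v' \<in> I" for v'
      using that by (auto simp: I_def A_def dest: lowD)
    have fin: "finite {v'. (v, v') \<in> low_pairs}"
      using finite_support by (rule rev_finite_subset) (auto simp: low_pairs_def)
    have fin_I: "finite I" using fin by (rule rev_finite_subset) (auto simp: I_def)
    have "(\<Sum>v' | (v, v') \<in> low_pairs. pmf D v' * h j (v(j := v' j)) (v'(j := v j)))
        = (\<Sum>v'\<in>I. pmf D v' * (x (v(j := v' j)) j * v' j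
            - utility (x (v(j := v' j))) (p (v(j := v' j))) (v(j := v' j))))"
      using fin by (intro sum.mono_neutral_cong_right) (auto simp: I_def h_def \<pi>_def)
    also have "\<dots> \<le> \<rho> j"
    proof (rule single_item_revenue_le[where z = "\<lambda>v'. v' j" and x = "\<lambda>s. x (v(j := s)) j"
          and u = "\<lambda>s. utility (x (v(j := s))) (p (v(j := s))) (v(j := s))"])
      fix i k assume i: "i \<in> I" and k: "k \<in> I"
      show "utility (x (v(j := k j))) (p (v(j := k j))) (v(j := k j)) + x (v(j := k j)) j * (i j - k j)
          \<le> utility (x (v(j := i j))) (p (v(j := i j))) (v(j := i j))"
        using truthful_mechanismD(4)[OF mech I_supp[OF i] I_supp[OF k]]
        by (simp add: utility_upd algebra_simps)
    next
      fix k assume k: "k \<in> I"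
      have "sum (pmf D) {i \<in> I. k j \<le> i j} \<le> (\<Sum>v' | v' \<in> low C \<and> k j \<le> v' j. pmf D v')"
        using I_low by (intro sum_mono2) auto
      then have "k j * sum (pmf D) {i \<in> I. k j \<le> i j}
          \<le> k j * (\<Sum>v' | v' \<in> low C \<and> k j \<le> v' j. pmf D v')"
        using value_nonneg[OF lowD(1)[OF I_low[OF k]]] by (rule mult_left_mono)
      also have "\<dots> \<le> \<rho> j" using \<rho>(3) I_low[OF k] by blast
      finally show "k j * sum (pmf D) {i \<in> I. k j \<le> i j} \<le> \<rho> j" .
    qed (use fin_I \<rho>(1) truthful_mechanismD[OF mech I_supp] in auto)
    finally show ?thesis .
  qed
  have "(\<Sum>v\<in>A. pmf D v) * (\<Sum>v\<in>A. pmf D v * \<pi> (favourite v) v)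
      = (\<Sum>v\<in>A. \<Sum>v'\<in>A. pmf D v * pmf D v' * \<pi> (favourite v) v)"
    by (rule weighted_sum_product)
  also have "\<dots> = E2 (\<lambda>v v'. of_bool (v \<in> A \<and> v' \<in> A) * \<pi> (favourite v) v)"
    unfolding A_def by (rule sum_low_times_low_eq_E2) simp
  also have "(\<lambda>v v'. of_bool (v \<in> A \<and> v' \<in> A) * \<pi> (favourite v) v)
      = (\<lambda>v v'. \<Sum>j\<in>UNIV. h j v v')"
  proof (intro ext)
    fix v v'
    have "(\<Sum>j\<in>UNIV. h j v v')
        = (\<Sum>j\<in>UNIV. if j = favourite v then of_bool (v \<in> A \<and> v' \<in> A) * \<pi> j v else 0)"
      by (intro sum.cong) (auto simp: h_def)
    then show "of_bool (v \<in> A \<and> v' \<in> A) * \<pi> (favourite v) v = (\<Sum>j\<in>UNIV. h j v v')" by simp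
  qed
  \<comment> \<open>Each summand is exchanged in its own coordinate \<open>j\<close>.\<close>
  also have "E2 (\<lambda>v v'. \<Sum>j\<in>UNIV. h j v v') = (\<Sum>j\<in>UNIV. E2 (\<lambda>v v'. h j (v(j := v' j)) (v'(j := v j))))"
    unfolding E2_sum by (intro sum.cong refl E2_swap)
  also have "\<dots> \<le> (\<Sum>j\<in>UNIV. \<Sum>v\<in>low C. pmf D v * \<rho> j)"
    unfolding E2_iterated by (intro sum_mono mult_left_mono line) auto
  also have "\<dots> = (\<Sum>v\<in>low C. pmf D v) * (\<Sum>j\<in>UNIV. \<rho> j)"
    by (simp add: sum_product sum.swap[of _ UNIV])
  also have "\<dots> \<le> 1 * t"
    using \<rho> sum_low_le_1 by (intro mult_mono) (auto intro: sum_nonneg)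
  finally have "(\<Sum>v\<in>A. pmf D v) * (\<Sum>v\<in>A. pmf D v * \<pi> (favourite v) v) \<le> t" by simp
  then have "2 / 3 * (\<Sum>v\<in>A. pmf D v * \<pi> (favourite v) v) \<le> t"
    using prob_low_half t_pos
      mult_right_mono[of "2/3" "\<Sum>v\<in>A. pmf D v" "\<Sum>v\<in>A. pmf D v * \<pi> (favourite v) v"]
    unfolding A_def by (cases "0 \<le> (\<Sum>v\<in>low (C / 2). pmf D v * \<pi> (favourite v) v)") auto
  then show ?thesis unfolding A_def \<pi>_def by simp
qed

section \<open>Tail and core of the non-favourite items\<close>

definition tail :: "'i valuation \<Rightarrow> real" where
  "tail v = (\<Sum>j\<in>UNIV. \<Sum>k\<in>-{j}. v j * of_bool (t < v j) * of_bool (v j \<le> v k))"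

definition core :: "'i valuation \<Rightarrow> real" where
  "core v = (\<Sum>j\<in>UNIV. v j * of_bool (v j \<le> t))"

text \<open>A non-favourite item above \<open>t\<close> is counted in \<open>tail\<close> through
  \<open>k = favourite v\<close>. Counting all dominating \<open>k\<close> is wasteful, but gives
  terms in two distinct coordinates that one exchange decouples.\<close>

lemma non_favourite_le:
  assumes "v \<in> set_pmf D"
  shows "(\<Sum>j\<in>-{favourite v}. v j) \<le> core v + tail v"
proof -
  let ?T = "\<lambda>j k. v j * of_bool (t < v j) * of_bool (v j \<le> v k)"
  have nn: "0 \<le> v j" for j using value_nonneg[OF assms] .
  have "v j \<le> v j * of_bool (v j \<le> t) + (\<Sum>k\<in>-{j}. ?T j k)" if "j \<noteq> favourite v" for j
  proof (cases "v j \<le> t")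
    case True
    then show ?thesis by simp
  next
    case False
    have "?T j (favourite v) \<le> (\<Sum>k\<in>-{j}. ?T j k)"
      using that nn by (intro member_le_sum) auto
    then show ?thesis using False le_favourite[of v j] by simp
  qed
  then have "(\<Sum>j\<in>-{favourite v}. v j)
      \<le> (\<Sum>j\<in>-{favourite v}. v j * of_bool (v j \<le> t) + (\<Sum>k\<in>-{j}. ?T j k))"
    by (intro sum_mono) auto
  also have "\<dots> \<le> (\<Sum>j\<in>UNIV. v j * of_bool (v j \<le> t) + (\<Sum>k\<in>-{j}. ?T j k))"
    using nn by (intro sum_mono2 add_nonneg_nonneg sum_nonneg) auto
  finally show ?thesis by (simp add: core_def tail_def sum.distrib)
qed

text \<open>Exchanging \<open>k\<close> leaves \<open>v j\<close> alone. For fixed \<open>v\<close>,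
  \<open>v j\<close> times the expected number of items of the second sample worth at least
  \<open>v j\<close> is at most \<open>t\<close>, by the uniform price \<open>v j\<close>. The
  uniform price \<open>t\<close> then bounds the remaining sum over \<open>v\<close> and
  \<open>j\<close>.\<close>

lemma tail_le: "(\<Sum>v\<in>low (C / 2). pmf D v * tail v) \<le> 3 / 2 * t"
proof -
  have tail_nn: "0 \<le> tail v" if "v \<in> set_pmf D" for v
    unfolding tail_def using value_nonneg[OF that] by (intro sum_nonneg) auto
  have "(\<Sum>v\<in>low (C / 2). pmf D v) * (\<Sum>v\<in>low (C / 2). pmf D v * tail v)
      = (\<Sum>v\<in>low (C / 2). \<Sum>v'\<in>low (C / 2). pmf D v * pmf D v' * tail v)"
    by (rule weighted_sum_product)
  also have "\<dots> = E2 (\<lambda>v v'. of_bool (v \<in> low (C / 2) \<and> v' \<in> low (C / 2)) * tail v)"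
    by (rule sum_low_times_low_eq_E2) simp
  also have "\<dots> \<le> E2 (\<lambda>v v'. tail v)"
    using tail_nn by (intro E2_mono) (auto simp: low_pairs_def)
  also have "\<dots> = (\<Sum>j\<in>UNIV. \<Sum>k\<in>-{j}. E2 (\<lambda>v v'. v j * of_bool (t < v j) * of_bool (v j \<le> v k)))"
    unfolding tail_def E2_sum ..
  also have "\<dots> = (\<Sum>j\<in>UNIV. \<Sum>k\<in>-{j}. E2 (\<lambda>v v'. v j * of_bool (t < v j) * of_bool (v j \<le> v' k)))"
  proof (intro sum.cong refl)
    fix j k :: 'i assume "k \<in> -{j}"
    then show "E2 (\<lambda>v v'. v j * of_bool (t < v j) * of_bool (v j \<le> v k))
        = E2 (\<lambda>v v'. v j * of_bool (t < v j) * of_bool (v j \<le> v' k))"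
      by (subst E2_swap[where j = k]) auto
  qed
  also have "\<dots> = E2 (\<lambda>v v'. \<Sum>j\<in>UNIV. \<Sum>k\<in>-{j}. v j * of_bool (t < v j) * of_bool (v j \<le> v' k))"
    unfolding E2_sum ..
  \<comment> \<open>Once decoupled, the term \<open>k = j\<close> can be added to complete the
    count.\<close>
  also have "\<dots> \<le> E2 (\<lambda>v v'. \<Sum>j\<in>UNIV. \<Sum>k\<in>UNIV. v j * of_bool (t < v j) * of_bool (v j \<le> v' k))"
    by (intro E2_mono sum_mono sum_mono2) (auto simp: low_pairs_def value_nonneg)
  also have "\<dots> \<le> (\<Sum>v\<in>low C. \<Sum>v'\<in>low C. pmf D v * pmf D v' *
      (\<Sum>j\<in>UNIV. \<Sum>k\<in>UNIV. v j * of_bool (t < v j) * of_bool (v j \<le> v' k)))"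
    by (intro E2_le_sum_low_times_low sum_nonneg) (auto dest: lowD intro: value_nonneg)
  also have "\<dots> = (\<Sum>v\<in>low C. \<Sum>j\<in>UNIV. pmf D v * of_bool (t < v j) *
      (v j * (\<Sum>v'\<in>low C. \<Sum>k\<in>UNIV. pmf D v' * of_bool (v j \<le> v' k))))"
    unfolding sum_distrib_left
    by (subst (2) sum.swap) (simp add: algebra_simps)
  also have "\<dots> \<le> (\<Sum>v\<in>low C. \<Sum>j\<in>UNIV. pmf D v * of_bool (t < v j) * t)"
    using value_nonneg by (intro sum_mono mult_left_mono uniform_price) (auto dest: lowD)
  also have "\<dots> \<le> (\<Sum>v\<in>low C. \<Sum>j\<in>UNIV. pmf D v * of_bool (t \<le> v j) * t)"
    using t_pos by (intro sum_mono mult_right_mono mult_left_mono) auto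
  also have "\<dots> \<le> t"
    using uniform_price[OF less_imp_le[OF t_pos]]
    unfolding sum_distrib_right[symmetric] by (simp only: mult.commute)
  finally have "(\<Sum>v\<in>low (C / 2). pmf D v) * (\<Sum>v\<in>low (C / 2). pmf D v * tail v) \<le> t" .
  moreover have "0 \<le> (\<Sum>v\<in>low (C / 2). pmf D v * tail v)"
    using tail_nn by (intro sum_nonneg) (auto dest: lowD)
  ultimately show ?thesis
    using mult_right_mono[OF prob_low_half, of "\<Sum>v\<in>low (C / 2). pmf D v * tail v"] by simp
qed

section \<open>Second moments of the core and comparison of two samples\<close>

lemma core_second_moment_le:
  "(\<Sum>v\<in>low C. pmf D v * (\<Sum>j\<in>UNIV. (v j * of_bool (v j \<le> t))\<^sup>2)) \<le> 2 * t * t"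
proof -
  \<comment> \<open>All pairs of a type and an item are pooled into one single-item population; its
    posted-price revenue is that of a uniform price.\<close>
  let ?z = "\<lambda>(v, j). v j * of_bool (v j \<le> t)" and ?I = "low C \<times> (UNIV :: 'i set)"
  have "(\<Sum>i\<in>?I. (case i of (v, j) \<Rightarrow> pmf D v) * (?z i)\<^sup>2) \<le> 2 * t * t"
  proof (rule sum_squares_le_of_price_bound)
    fix i assume "i \<in> ?I"
    then show z: "0 \<le> ?z i \<and> ?z i \<le> t"
      using t_pos by (auto dest!: lowD(1) simp: value_nonneg of_bool_def)
  next
    fix k assume "k \<in> ?I"
    then have z: "0 \<le> ?z k" by (auto dest!: lowD(1) simp: value_nonneg)
    have "sum (\<lambda>(v, j). pmf D v) {i \<in> ?I. ?z k \<le> ?z i}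
        = (\<Sum>(v, j)\<in>?I. pmf D v * of_bool (?z k \<le> v j * of_bool (v j \<le> t)))"
      unfolding sum.inter_filter[OF finite_cartesian_product[OF finite_low finite]]
      by (intro sum.cong) auto
    also have "\<dots> \<le> (\<Sum>(v, j)\<in>?I. pmf D v * of_bool (?z k \<le> v j))"
      using z by (intro sum_mono) (auto dest!: lowD(1) simp: value_nonneg of_bool_def)
    also have "\<dots> = (\<Sum>v\<in>low C. \<Sum>j\<in>UNIV. pmf D v * of_bool (?z k \<le> v j))"
      by (rule sum.cartesian_product[symmetric])
    finally have "?z k * sum (\<lambda>(v, j). pmf D v) {i \<in> ?I. ?z k \<le> ?z i}
        \<le> ?z k * (\<Sum>v\<in>low C. \<Sum>j\<in>UNIV. pmf D v * of_bool (?z k \<le> v j))"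
      using z by (rule mult_left_mono)
    also have "\<dots> \<le> t" using z by (rule uniform_price)
    finally show "?z k * sum (\<lambda>(v, j). pmf D v) {i \<in> ?I. ?z k \<le> ?z i} \<le> t" .
  qed (use t_pos in auto)
  then show ?thesis
    by (simp add: sum.cartesian_product sum_distrib_left case_prod_beta)
qed

lemma E2_eq_0_of_swap:
  assumes "\<And>v v'. h (v(j := v' j)) (v'(j := v j)) = - h v v'"
  shows "E2 h = 0"
proof -
  have "E2 h = E2 (\<lambda>v v'. (-1) * h v v')" by (subst E2_swap[where j = j]) (simp add: assms)
  then show ?thesis unfolding E2_cmult by simp
qed

lemma E2_add_le:
  assumes F: "\<And>v. v \<in> low C \<Longrightarrow> 0 \<le> F v"
  shows "E2 (\<lambda>v v'. F v + F v') \<le> 2 * (\<Sum>v\<in>low C. pmf D v * F v)"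
proof -
  have "E2 (\<lambda>v v'. F v + F v') \<le> (\<Sum>v\<in>low C. \<Sum>v'\<in>low C. pmf D v * pmf D v' * (F v + F v'))"
    using F by (intro E2_le_sum_low_times_low) (auto intro: add_nonneg_nonneg)
  also have "\<dots> = (\<Sum>v\<in>low C. pmf D v) * (\<Sum>v\<in>low C. pmf D v * F v)
      + (\<Sum>v\<in>low C. pmf D v) * (\<Sum>v\<in>low C. pmf D v * F v)"
    unfolding distrib_left sum.distrib
    by (intro arg_cong2[where f = "(+)"] weighted_sum_product[symmetric])
      (simp add: sum_product mult.assoc)
  also have "\<dots> \<le> 1 * (\<Sum>v\<in>low C. pmf D v * F v) + 1 * (\<Sum>v\<in>low C. pmf D v * F v)"
    using F sum_low_le_1 by (intro add_mono mult_left_mono mult_right_mono sum_nonneg) auto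
  finally show ?thesis by simp
qed

text \<open>Exchanging \<open>j\<close> negates \<open>c j\<close> and fixes \<open>c k\<close> for
  \<open>k \<noteq> j\<close>, so the cross terms vanish although coordinates of \<open>D\<close>
  may be correlated.\<close>

lemma core_difference_second_moment_le: "E2 (\<lambda>v v'. (core v - core v')\<^sup>2) \<le> 4 * t\<^sup>2"
proof -
  define c where "c = (\<lambda>j (v :: 'i valuation) v'. v j * of_bool (v j \<le> t) - v' j * of_bool (v' j \<le> t))"
  have c: "core v - core v' = (\<Sum>j\<in>UNIV. c j v v')" for v v'
    by (simp add: core_def c_def sum_subtractf)
  have off_diag: "E2 (\<lambda>v v'. c j v v' * c k v v') = 0" if "j \<noteq> k" for j k
    using that by (intro E2_eq_0_of_swap[where j = j]) (auto simp: c_def algebra_simps)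
  have "E2 (\<lambda>v v'. (core v - core v')\<^sup>2) = (\<Sum>j\<in>UNIV. \<Sum>k\<in>UNIV. E2 (\<lambda>v v'. c j v v' * c k v v'))"
    unfolding c power2_eq_square sum_product E2_sum ..
  also have "\<dots> = (\<Sum>j\<in>UNIV. \<Sum>k\<in>UNIV. if k = j then E2 (\<lambda>v v'. c j v v' * c j v v') else 0)"
    by (intro sum.cong) (auto simp: off_diag)
  also have "\<dots> = E2 (\<lambda>v v'. \<Sum>j\<in>UNIV. c j v v' * c j v v')"
    by (simp add: E2_sum)
  \<comment> \<open>For nonnegative numbers the square of a difference is at most the sum of the
    squares.\<close>
  also have "\<dots> \<le> E2 (\<lambda>v v'. (\<Sum>j\<in>UNIV. (v j * of_bool (v j \<le> t))\<^sup>2)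
      + (\<Sum>j\<in>UNIV. (v' j * of_bool (v' j \<le> t))\<^sup>2))"
    unfolding sum.distrib[symmetric]
    by (intro E2_mono sum_mono) (auto simp: c_def power2_eq_square low_pairs_def value_nonneg algebra_simps)
  also have "\<dots> \<le> 2 * (\<Sum>v\<in>low C. pmf D v * (\<Sum>j\<in>UNIV. (v j * of_bool (v j \<le> t))\<^sup>2))"
    by (intro E2_add_le sum_nonneg) auto
  also have "\<dots> \<le> 4 * t\<^sup>2"
    using core_second_moment_le by (simp add: power2_eq_square)
  finally show ?thesis .
qed

lemma E2_core_difference: "E2 (\<lambda>v v'. core v - core v') = 0"
proof -
  have "E2 (\<lambda>v v'. core v - core v')
      = (\<Sum>j\<in>UNIV. E2 (\<lambda>v v'. v j * of_bool (v j \<le> t) - v' j * of_bool (v' j \<le> t)))"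
    unfolding core_def sum_subtractf[symmetric] E2_sum ..
  also have "\<dots> = 0"
    by (intro sum.neutral ballI E2_eq_0_of_swap) auto
  finally show ?thesis .
qed

lemma E2_1_le: "E2 (\<lambda>v v'. 1) \<le> 1"
  using E2_add_le[of "\<lambda>_. 1/2"] sum_low_le_1[of C]
  by (simp add: sum_divide_distrib[symmetric])

lemma core_le: "(\<Sum>v\<in>low (C / 2). pmf D v * core v) \<le> 2 * B + 2 * t"
proof -
  define A where "A = low (C / 2)"
  define G where "G = low (2 * B)"
  define d where "d = (\<lambda>v v'. core v - core v')"
  have core_le_B: "core v \<le> 2 * B" if "v \<in> G" for v
  proof -
    have v: "v \<in> set_pmf D" "l1_norm v \<le> 2 * B" using that by (auto simp: G_def dest: lowD)
    have "core v \<le> sum v UNIV"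
      unfolding core_def using value_nonneg[OF v(1)] by (intro sum_mono) auto
    then show ?thesis using l1_norm_eq_sum[of v] value_nonneg[OF v(1)] v(2) by simp
  qed
  \<comment> \<open>The right-hand side is \<open>(y + 2 * t)\<^sup>2 / (8 * t)\<close>. It must
    dominate both \<open>y\<close> and 0, since the indicator of \<open>A \<times> G\<close> yields
    one or the other. Mean zero and second moment at most \<open>4 * t\<^sup>2\<close> make its
    \<open>E2\<close> at most \<open>t\<close>.\<close>
  have pointwise: "y \<le> 1 / 2 * y + (1 / (8 * t) * y\<^sup>2 + t / 2 * 1)"
    "0 \<le> 1 / 2 * y + (1 / (8 * t) * y\<^sup>2 + t / 2 * 1)" for y :: real
  proof -
    have "0 \<le> (y - 2 * t)\<^sup>2 / (8 * t)" "0 \<le> (y + 2 * t)\<^sup>2 / (8 * t)" using t_pos by auto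
    then show "y \<le> 1 / 2 * y + (1 / (8 * t) * y\<^sup>2 + t / 2 * 1)"
      "0 \<le> 1 / 2 * y + (1 / (8 * t) * y\<^sup>2 + t / 2 * 1)"
      using t_pos by (simp_all add: power2_eq_square field_simps)
  qed
  have "(\<Sum>v\<in>A. \<Sum>v'\<in>G. pmf D v * pmf D v' * d v v')
      = E2 (\<lambda>v v'. of_bool (v \<in> A \<and> v' \<in> G) * d v v')"
    unfolding A_def G_def using B_less C_pos by (intro sum_low_times_low_eq_E2) simp
  also have "\<dots> \<le> E2 (\<lambda>v v'. 1 / 2 * d v v' + (1 / (8 * t) * (d v v')\<^sup>2 + t / 2 * 1))"
    using pointwise by (intro E2_mono) (auto simp: of_bool_def)
  also have "\<dots> = 1 / 2 * E2 d + (1 / (8 * t) * E2 (\<lambda>v v'. (d v v')\<^sup>2) + t / 2 * E2 (\<lambda>v v'. 1))"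
    unfolding E2_add E2_cmult by simp
  also have "\<dots> \<le> 1 / 2 * 0 + (1 / (8 * t) * (4 * t\<^sup>2) + t / 2 * 1)"
    using E2_core_difference core_difference_second_moment_le E2_1_le t_pos
    unfolding d_def by (intro add_mono mult_left_mono) auto
  also have "\<dots> = t" using t_pos by (simp add: power2_eq_square field_simps)
  finally have diff: "(\<Sum>v\<in>A. \<Sum>v'\<in>G. pmf D v * pmf D v' * d v v') \<le> t" .
  have "(\<Sum>v\<in>G. pmf D v) * (\<Sum>v\<in>A. pmf D v * core v)
      = (\<Sum>v\<in>A. \<Sum>v'\<in>G. pmf D v * pmf D v' * core v)"
    by (rule weighted_sum_product)
  also have "\<dots> \<le> (\<Sum>v\<in>A. \<Sum>v'\<in>G. pmf D v * pmf D v' * (2 * B + d v v'))"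
    using core_le_B by (intro sum_mono mult_left_mono) (auto simp: d_def)
  also have "\<dots> = (\<Sum>v\<in>A. pmf D v) * ((\<Sum>v\<in>G. pmf D v) * (2 * B))
      + (\<Sum>v\<in>A. \<Sum>v'\<in>G. pmf D v * pmf D v' * d v v')"
    unfolding distrib_left sum.distrib sum_distrib_right[of _ G] sum_product
    by (simp add: mult.assoc)
  \<comment> \<open>Keeping the factor P(\<open>G\<close>) beside \<open>2 * B\<close> lets it
    cancel, so dividing by P(\<open>G\<close>) doubles only \<open>t\<close>.\<close>
  also have "\<dots> \<le> 1 * ((\<Sum>v\<in>G. pmf D v) * (2 * B)) + t"
    using diff sum_low_le_1 B_pos unfolding A_def
    by (intro add_mono mult_right_mono) (auto intro!: mult_nonneg_nonneg sum_nonneg)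
  finally have "(\<Sum>v\<in>G. pmf D v) * ((\<Sum>v\<in>A. pmf D v * core v) - 2 * B) \<le> t"
    by (simp add: algebra_simps)
  then have "1 / 2 * ((\<Sum>v\<in>A. pmf D v * core v) - 2 * B) \<le> t"
    using prob_low_2B t_pos
      mult_right_mono[of "1/2" "\<Sum>v\<in>G. pmf D v" "(\<Sum>v\<in>A. pmf D v * core v) - 2 * B"]
    unfolding G_def by (cases "0 \<le> (\<Sum>v\<in>A. pmf D v * core v) - 2 * B") auto
  then show ?thesis unfolding A_def by simp
qed

text \<open>Favourite, tail and core contribute \<open>3/2 * t\<close>, \<open>3/2 * t\<close> and
  \<open>2 * t + 2 * B\<close>; types above \<open>C / 2\<close> add \<open>2 * B\<close>. The total
  of \<open>4 * B\<close> is relaxed to \<open>6 * B\<close>, the coefficient forced by the case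
  \<open>C \<le> 6 * B\<close>.\<close>

lemma expected_payment_le_price_bounds:
  assumes mech: "truthful_mechanism D x p"
    and payment: "\<And>v. v \<in> set_pmf D \<Longrightarrow> p v \<le> C"
  shows "expected_payment D p \<le> 5 * t + 6 * B"
proof -
  have "p v \<le> (x v (favourite v) * v (favourite v) - utility (x v) (p v) v) + (core v + tail v)"
    if v: "v \<in> set_pmf D" for v
  proof -
    have "(\<Sum>j\<in>UNIV. x v j * v j)
        = x v (favourite v) * v (favourite v) + (\<Sum>j\<in>-{favourite v}. x v j * v j)"
      by (subst sum.remove[of _ "favourite v"]) (auto simp: Compl_eq_Diff_UNIV)
    moreover have "(\<Sum>j\<in>-{favourite v}. x v j * v j) \<le> (\<Sum>j\<in>-{favourite v}. v j)"
      using truthful_mechanismD[OF mech v] value_nonneg[OF v]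
      by (intro sum_mono mult_left_le_one_le) auto
    ultimately show ?thesis
      using non_favourite_le[OF v] by (simp add: utility_def)
  qed
  then have "(\<Sum>v\<in>low (C / 2). pmf D v * p v) \<le> (\<Sum>v\<in>low (C / 2). pmf D v *
      ((x v (favourite v) * v (favourite v) - utility (x v) (p v) v) + (core v + tail v)))"
    by (intro sum_mono mult_left_mono) (auto dest: lowD)
  also have "\<dots> = (\<Sum>v\<in>low (C / 2). pmf D v *
      (x v (favourite v) * v (favourite v) - utility (x v) (p v) v))
      + ((\<Sum>v\<in>low (C / 2). pmf D v * core v) + (\<Sum>v\<in>low (C / 2). pmf D v * tail v))"
    by (simp add: sum.distrib distrib_left)
  also have "\<dots> \<le> 5 * t + 2 * B"
    using favourite_revenue_le[OF mech] core_le tail_le by linarith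
  finally have low_part: "(\<Sum>v\<in>low (C / 2). pmf D v * p v) \<le> 5 * t + 2 * B" .
  have "(\<Sum>v\<in>set_pmf D - low (C / 2). pmf D v * p v) \<le> (\<Sum>v\<in>set_pmf D - low (C / 2). pmf D v * C)"
    using payment by (intro sum_mono mult_left_mono) auto
  also have "\<dots> \<le> 2 * B"
    using prob_above_half by (simp add: sum_distrib_left mult.commute)
  finally have high_part: "(\<Sum>v\<in>set_pmf D - low (C / 2). pmf D v * p v) \<le> 2 * B" .
  have "expected_payment D p = (\<Sum>v\<in>set_pmf D - low (C / 2). pmf D v * p v)
      + (\<Sum>v\<in>low (C / 2). pmf D v * p v)"
    unfolding expected_payment_def using finite_support
    by (intro sum.subset_diff) (auto simp: low_def)
  then show ?thesis using low_part high_part B_pos by linarith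
qed

end


section \<open>Weakly correlated distributions\<close>

lemma (in exchangeable_values) Rev_le:
  assumes C: "0 < C" "C \<le> b"
    and cap: "\<And>v. v \<in> set_pmf D \<Longrightarrow> min b (l1_norm v) \<le> C"
  shows "Rev b D \<le> 5 * SRev b D + 6 * BRev b D"
proof (rule field_le_epsilon)
  fix e :: real assume e: "0 < e"
  have b: "0 < b" using C by linarith
  \<comment> \<open>The slack keeps \<open>t\<close> and \<open>B\<close> positive even if a revenue
    is 0; it sums to \<open>e\<close> because 5 + 6 = 11.\<close>
  define t where "t = SRev b D + e / 11"
  define B where "B = BRev b D + e / 11"
  have t: "0 < t" "SRev b D \<le> t"
    using SRev_nonneg[of b D] finite_support b e by (auto simp: t_def)
  have B: "0 < B" "BRev b D \<le> B"
    using BRev_upper[of 0 b D] b e by (auto simp: B_def)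
  have "expected_payment D p \<le> 5 * t + 6 * B"
    if mech: "truthful_mechanism D x p" and budget: "\<forall>v\<in>set_pmf D. p v \<le> b" for x p
  proof -
    have payment: "p v \<le> C" if v: "v \<in> set_pmf D" for v
    proof -
      have "p v \<le> (\<Sum>j\<in>UNIV. x v j * v j)"
        using truthful_mechanismD(3)[OF mech v] by (simp add: utility_def)
      also have "\<dots> \<le> sum v UNIV"
        using truthful_mechanismD(1,2)[OF mech v] value_nonneg[OF v]
        by (intro sum_mono mult_left_le_one_le) auto
      also have "\<dots> = l1_norm v" using l1_norm_eq_sum[of v] value_nonneg[OF v] by simp
      finally show ?thesis using cap[OF v] budget v by force
    qed
    show ?thesis
    proof (cases "6 * B < C")
      case True
      interpret revenue_bounds D C b t B
        by unfold_locales (use C t B True in auto)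
      show ?thesis using expected_payment_le_price_bounds[OF mech payment] .
    next
      case False
      then show ?thesis using expected_payment_le[OF finite_support, of p C] payment t by force
    qed
  qed
  then have "Rev b D \<le> 5 * t + 6 * B"
    unfolding Rev_def using mechanism_revenues_nonempty[of b D] b
    by (intro cSup_least) (auto simp: mechanism_revenues_def)
  then show "Rev b D \<le> 5 * SRev b D + 6 * BRev b D + e"
    by (simp add: t_def B_def)
qed

text \<open>A product mass function is invariant under exchanges, and conditioning divides it by a
  constant on the event, which contains all four vectors.\<close>

lemma weakly_correlated_exchangeable:
  assumes "weakly_correlated D"
  obtains c where "0 < c" "\<And>v. v \<in> set_pmf D \<Longrightarrow> l1_norm v \<le> c"
    and "\<And>C. C \<le> c \<Longrightarrow> exchangeable_values D C"
proof -
  obtain V c M where V: "value_distribution V" "V = Pi_pmf UNIV 0 M" and c: "0 < c"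
    and pos: "measure_pmf.prob V {v. l1_norm v \<le> c} > 0"
    and D: "D = cond_pmf V {v. l1_norm v \<le> c}"
    using assms by (auto simp: weakly_correlated_def independent_distribution_def)
  have ne: "set_pmf V \<inter> {v. l1_norm v \<le> c} \<noteq> {}"
    using pos by (metis measure_pmf_zero_iff less_irrefl)
  have supp: "set_pmf D = set_pmf V \<inter> {v. l1_norm v \<le> c}"
    unfolding D using ne by (rule set_cond_pmf)
  have pmf_V: "pmf V v = (\<Prod>j\<in>UNIV. pmf (M j) (v j))" for v
    unfolding V(2) by (subst pmf_Pi) auto
  have swap_V: "pmf V (v(j := v' j)) * pmf V (v'(j := v j)) = pmf V v * pmf V v'" for v v' j
    unfolding pmf_V prod.distrib[symmetric] by (intro prod.cong) auto
  show ?thesis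
  proof (rule that[OF c])
    show "l1_norm v \<le> c" if "v \<in> set_pmf D" for v using that supp by auto
    fix C assume C: "C \<le> c"
    show "exchangeable_values D C"
    proof
      show "value_distribution D"
        using V(1) supp by (auto simp: value_distribution_def)
      fix v v' :: "'a valuation" and j
      assume le: "l1_norm v + l1_norm v' \<le> C"
      have "l1_norm w \<le> c" if "w \<in> {v, v', v(j := v' j), v'(j := v j)}" for w
        using that le C l1_norm_nonneg[of v] l1_norm_nonneg[of v'] l1_norm_swap[of v j v']
          l1_norm_nonneg[of "v(j := v' j)"] l1_norm_nonneg[of "v'(j := v j)"] by auto
      then show "pmf D (v(j := v' j)) * pmf D (v'(j := v j)) = pmf D v * pmf D v'"
        unfolding D using swap_V[of v j v'] by (simp add: pmf_cond[OF ne])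
    qed
  qed
qed

theorem corollary2:
  fixes b :: real and V_hat :: "('i::finite \<Rightarrow> real) pmf"
  assumes "b > 0"
    and "weakly_correlated V_hat"
  shows "Rev b V_hat \<le> 5 * SRev b V_hat + 6 * BRev b V_hat \<and>
    Rev b V_hat / 11 \<le> max (SRev b V_hat) (BRev b V_hat)"
proof -
  obtain c where c: "0 < c" "\<And>v. v \<in> set_pmf V_hat \<Longrightarrow> l1_norm v \<le> c"
    "\<And>C. C \<le> c \<Longrightarrow> exchangeable_values V_hat C"
    using weakly_correlated_exchangeable[OF assms(2)] by blast
  \<comment> \<open>The minimum serves two purposes: \<open>C \<le> c\<close> permits exchanges, and
    \<open>C \<le> b\<close> keeps the budget slack on \<open>low C\<close>.\<close>
  interpret exchangeable_values V_hat "min b c"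
    using c(3) by simp
  have "Rev b V_hat \<le> 5 * SRev b V_hat + 6 * BRev b V_hat"
    using assms(1) c(1,2) by (intro Rev_le) force+
  moreover from this have "Rev b V_hat / 11 \<le> max (SRev b V_hat) (BRev b V_hat)"
    by (simp add: max_def)
  ultimately show ?thesis by blast
qed

end
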